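(* Assume that $T$ is continuous on $C$, that $S_*\neq\varnothing$ and that $S_*\subseteq S_{\rm dual}$. Let $(x^k)_{k\in\mathbb{N}}$ be an infinite sequence generated by Conceptual Algorithm B with Variant B.1, that is, $x^{k+1}=P_C\big(P_{H(z^k,\bar v^k)}(x^k)\big)$, such that $x^k\notin S_*$ for all $k\in\mathbb{N}$. Then $(x^k)_{k\in\mathbb{N}}$ converges to a point in $S_*$.
   Context: $\mathbb{R}^n$ carries the Euclidean inner product $\langle\cdot,\cdot\rangle$ and norm $\|\cdot\|$; $\mathbb{N}=\{0,1,2,\dots\}$. $T:\operatorname{dom}(T)\subseteq\mathbb{R}^n\to\mathbb{R}^n$ is an operator and $C\subseteq\operatorname{dom}(T)$ is nonempty, closed and convex. $P_S$ is the orthogonal projection onto a nonempty closed convex set $S$. For $x\in C$, $\mathcal{N}_C(x)=\{u\in\mathbb{R}^n:\langle u,y-x\rangle\le 0\ \forall y\in C\}$. $S_*=\{x_*\in C:\langle T(x_* ),x-x_*\rangle\ge0\ \forall x\in C\}$ and $S_{\rm dual}=\{x_*\in C:\langle T(x),x-x_*\rangle\ge0\ \forall x\in C\}$. For $z\in C$ and $v\in\mathcal{N}_C(z)$, $H(z,v)=\{y\in\mathbb{R}^n:\langle T(z)+v,y-z\rangle\le0\}$. Conceptual Algorithm B. Fix $\sigma>0$, $\delta,\theta\in(0,1)$, $M>0$. Linesearch B, for input $x\in C$, $u\in\mathcal{N}_C(x)$: start with $\alpha=\sigma$. For each trial $\alpha$ let $z_\alpha=P_C(x-\alpha(T(x)+\alpha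 u))$ and choose any $v_\alpha\in\mathcal{N}_C(z_\alpha)$ with $\|v_\alpha\|\le M$. While $\alpha\|T(z_\alpha)-T(x)+\alpha v_\alpha-\alpha u\|>\delta\|z_\alpha-x\|$, replace $\alpha$ by $\theta\alpha$ (and choose a new such $v_\alpha$). Output $(\alpha,z_\alpha,v_\alpha)$. Algorithm: take $x^0\in C$. At iteration $k$, stop if $x^k=P_C(x^k-T(x^k))$. Otherwise choose any $u^k\in\mathcal{N}_C(x^k)$ with $\|u^k\|\le M$, let $(\alpha_k,z^k,v^k)$ be the output of Linesearch B for input $(x^k,u^k)$, set $\bar v^k=\alpha_kv^k$, and compute $x^{k+1}$ by the update rule of the chosen variant. *)

theory Defs
  imports "HOL-Analysis.Analysis"
begin

text \<open>
  The operator \<open>T\<close> with \<open>C \<subseteq> dom(T)\<close> is a total function all of whose evaluations below are at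
  points of \<open>C\<close>, so its values off \<open>C\<close> are irrelevant. The orthogonal projection onto a nonempty
  closed convex set is the library's \<open>closest_point\<close>.
\<close>

definition normal_cone :: "'a::euclidean_space set \<Rightarrow> 'a \<Rightarrow> 'a set" where
  "normal_cone C x = {u. \<forall>y\<in>C. u \<bullet> (y - x) \<le> 0}"

definition VI_solutions :: "('a::euclidean_space \<Rightarrow> 'a) \<Rightarrow> 'a set \<Rightarrow> 'a set" where
  "VI_solutions T C = {xs \<in> C. \<forall>x\<in>C. T xs \<bullet> (x - xs) \<ge> 0}"

definition dual_VI_solutions :: "('a::euclidean_space \<Rightarrow> 'a) \<Rightarrow> 'a set \<Rightarrow> 'a set" where
  "dual_VI_solutions T C = {xs \<in> C. \<forall>x\<in>C. T x \<bullet> (x - xs) \<ge> 0}"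

definition sep_halfspace :: "('a::euclidean_space \<Rightarrow> 'a) \<Rightarrow> 'a \<Rightarrow> 'a \<Rightarrow> 'a set" where
  "sep_halfspace T z v = {y. (T z + v) \<bullet> (y - z) \<le> 0}"

text \<open>
  \<open>linesearchB_from T C \<delta> \<theta> M x u \<alpha> (\<alpha>', z, v)\<close>: the while loop, entered with trial step size \<open>\<alpha>\<close>,
  can terminate with output \<open>(\<alpha>', z, v)\<close>. It is a relation because the vector \<open>v\<close> is chosen
  afresh, arbitrarily within the bound \<open>M\<close>, for every trial step size.
\<close>

inductive linesearchB_from ::
  "('a::euclidean_space \<Rightarrow> 'a) \<Rightarrow> 'a set \<Rightarrow> real \<Rightarrow> real \<Rightarrow> real \<Rightarrow> 'a \<Rightarrow> 'a \<Rightarrow>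
    real \<Rightarrow> real \<times> 'a \<times> 'a \<Rightarrow> bool"
  for T C \<delta> \<theta> M x u where
  accept:
    "\<lbrakk>z = closest_point C (x - \<alpha> *\<^sub>R (T x + \<alpha> *\<^sub>R u));
      v \<in> normal_cone C z; norm v \<le> M;
      \<not> \<alpha> * norm (T z - T x + \<alpha> *\<^sub>R v - \<alpha> *\<^sub>R u) > \<delta> * norm (z - x)\<rbrakk>
     \<Longrightarrow> linesearchB_from T C \<delta> \<theta> M x u \<alpha> (\<alpha>, z, v)"
| backtrack:
    "\<lbrakk>z = closest_point C (x - \<alpha> *\<^sub>R (T x + \<alpha> *\<^sub>R u));
      v \<in> normal_cone C z; norm v \<le> M;
      \<alpha> * norm (T z - T x + \<alpha> *\<^sub>R v - \<alpha> *\<^sub>R u) > \<delta> * norm (z - x);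
      linesearchB_from T C \<delta> \<theta> M x u (\<theta> * \<alpha>) out\<rbrakk>
     \<Longrightarrow> linesearchB_from T C \<delta> \<theta> M x u \<alpha> out"

definition linesearchB ::
  "('a::euclidean_space \<Rightarrow> 'a) \<Rightarrow> 'a set \<Rightarrow> real \<Rightarrow> real \<Rightarrow> real \<Rightarrow> real \<Rightarrow> 'a \<Rightarrow> 'a \<Rightarrow>
    real \<times> 'a \<times> 'a \<Rightarrow> bool" where
  "linesearchB T C \<sigma> \<delta> \<theta> M x u out \<longleftrightarrow> linesearchB_from T C \<delta> \<theta> M x u \<sigma> out"

text \<open>
  An update rule \<open>F\<close> (the variant) gives the next iterate as \<open>F x\<^sup>k z\<^sup>k v\<close>, where \<open>v\<close> is the
  rescaled vector \<open>\<alpha>\<^sub>k v\<^sup>k\<close>. That the sequence is infinite means the stopping test fails at every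
  iteration.
\<close>

definition algorithmB_sequence ::
  "('a \<Rightarrow> 'a \<Rightarrow> 'a \<Rightarrow> 'a) \<Rightarrow> ('a::euclidean_space \<Rightarrow> 'a) \<Rightarrow> 'a set \<Rightarrow>
    real \<Rightarrow> real \<Rightarrow> real \<Rightarrow> real \<Rightarrow> (nat \<Rightarrow> 'a) \<Rightarrow> bool" where
  "algorithmB_sequence F T C \<sigma> \<delta> \<theta> M x \<longleftrightarrow>
     x 0 \<in> C \<and>
     (\<forall>k. x k \<noteq> closest_point C (x k - T (x k)) \<and>
       (\<exists>u \<alpha> z v.
          u \<in> normal_cone C (x k) \<and> norm u \<le> M \<and>
          linesearchB T C \<sigma> \<delta> \<theta> M (x k) u (\<alpha>, z, v) \<and>
          x (Suc k) = F (x k) z (\<alpha> *\<^sub>R v)))"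

definition variant_B1 ::
  "('a::euclidean_space \<Rightarrow> 'a) \<Rightarrow> 'a set \<Rightarrow> 'a \<Rightarrow> 'a \<Rightarrow> 'a \<Rightarrow> 'a" where
  "variant_B1 T C x z vbar = closest_point C (closest_point (sep_halfspace T z vbar) x)"

end

theory Submission imports Defs begin

text \<open>
  Every solution lies in the separating halfspaces, so the iterates are Fejer monotone with respect
  to the solution set and the distances from \<open>x\<^sup>k\<close> to the halfspaces tend to zero, which forces
  \<open>\<parallel>x\<^sup>k - z\<^sup>k\<parallel>\<^sup>2 / \<alpha>\<^sub>k \<rightarrow> 0\<close>. Take a cluster point along which \<open>\<alpha>\<^sub>k\<close> converges. If the limit of \<open>\<alpha>\<^sub>k\<close>
  is positive, \<open>(x\<^sup>k - z\<^sup>k) / \<alpha>\<^sub>k\<close> tends to zero; if it is zero, the same holds for the last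
  rejected trial step \<open>\<alpha>\<^sub>k / \<theta>\<close>, by its rejection and the continuity of \<open>T\<close>. In both cases the
  variational inequality of the projection passes to the limit, so the cluster point is a solution,
  and Fejer monotonicity makes the whole sequence converge to it.
\<close>

section \<open>Projection inequalities and the length and angle of a projected step\<close>

lemma closest_point_Pythagoras_le:
  fixes S :: "'a::euclidean_space set"
  assumes "convex S" "closed S" "y \<in> S"
  shows "(norm (closest_point S a - y))\<^sup>2 + (norm (a - closest_point S a))\<^sup>2 \<le> (norm (a - y))\<^sup>2"
proof -
  have "(a - closest_point S a) \<bullet> (y - closest_point S a) \<le> 0"
    using assms by (rule closest_point_dot)
  then show ?thesis
    unfolding power2_norm_eq_inner by (simp add: inner_diff_left inner_diff_right inner_commute)
qed

text \<open>Since \<open>x\<close> is its own projection, nonexpansiveness compares the projected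
  step with the unprojected one. The bound serves twice: it confines the points \<open>z k\<close>
  to a ball, and it makes trial points with vanishing step sizes approach \<open>x\<close>.\<close>

lemma norm_projected_step_le:
  fixes C :: "'a::euclidean_space set"
  assumes "convex C" "closed C" "x \<in> C" "0 \<le> \<alpha>"
  shows "norm (closest_point C (x - \<alpha> *\<^sub>R (t + \<alpha> *\<^sub>R u)) - x) \<le> \<alpha> * (norm t + \<alpha> * norm u)"
proof -
  have "norm (closest_point C (x - \<alpha> *\<^sub>R (t + \<alpha> *\<^sub>R u)) - x)
      \<le> norm ((x - \<alpha> *\<^sub>R (t + \<alpha> *\<^sub>R u)) - x)"
    using closest_point_lipschitz[of C "x - \<alpha> *\<^sub>R (t + \<alpha> *\<^sub>R u)" x] assms
    by (auto simp: closest_point_self dist_norm)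
  also have "\<dots> = \<alpha> * norm (t + \<alpha> *\<^sub>R u)"
    using assms by simp
  also have "\<dots> \<le> \<alpha> * (norm t + \<alpha> * norm u)"
    using norm_triangle_ineq[of t "\<alpha> *\<^sub>R u"] assms(4) by (intro mult_left_mono) auto
  finally show ?thesis .
qed

text \<open>An approximate variational inequality at \<open>x\<close>: its error vanishes once
  \<open>norm (z - x) / \<alpha>\<close> tends to zero with \<alpha> bounded. It is the obtuse-angle
  property of the projection, tested at \<open>y\<close> and divided by \<alpha>.\<close>

lemma projected_step_inner_ge:
  fixes C :: "'a::euclidean_space set"
  assumes "convex C" "closed C" "y \<in> C" "u \<in> normal_cone C x" "norm u \<le> M" "0 < \<alpha>"
    and z: "z = closest_point C (x - \<alpha> *\<^sub>R (t + \<alpha> *\<^sub>R u))"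
  shows "- (norm (z - x) / \<alpha> * norm (y - z)) - \<alpha> * (M * norm (z - x)) \<le> t \<bullet> (y - z)"
proof -
  have "(x - \<alpha> *\<^sub>R (t + \<alpha> *\<^sub>R u) - z) \<bullet> (y - z) \<le> 0"
    unfolding z using assms(1-3) by (rule closest_point_dot)
  then have "(x - z) \<bullet> (y - z) \<le> \<alpha> * (t \<bullet> (y - z) + \<alpha> * (u \<bullet> (y - z)))"
    by (simp add: algebra_simps inner_diff_left inner_diff_right inner_add_left)
  moreover have "- (norm (z - x) * norm (y - z)) \<le> (x - z) \<bullet> (y - z)"
    using Cauchy_Schwarz_ineq2[of "x - z" "y - z"] by (simp add: norm_minus_commute)
  ultimately have "- (norm (z - x) * norm (y - z)) \<le> \<alpha> * (t \<bullet> (y - z) + \<alpha> * (u \<bullet> (y - z)))"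
    by linarith
  then have "- (norm (z - x) / \<alpha> * norm (y - z)) \<le> t \<bullet> (y - z) + \<alpha> * (u \<bullet> (y - z))"
    using \<open>0 < \<alpha>\<close> by (simp add: field_simps)
  \<comment> \<open>Splitting at \<open>x\<close>, the part along \<open>y - x\<close> is
    nonpositive because \<open>u\<close> is normal at \<open>x\<close>; only the short displacement
    \<open>x - z\<close> is left to estimate.\<close>
  moreover have "u \<bullet> (y - z) \<le> M * norm (z - x)"
  proof -
    have "u \<bullet> (y - z) = u \<bullet> (y - x) + u \<bullet> (x - z)"
      by (simp add: inner_diff_right)
    also have "\<dots> \<le> 0 + norm u * norm (x - z)"
      using assms(3,4) by (intro add_mono norm_cauchy_schwarz) (auto simp: normal_cone_def)
    also have "\<dots> \<le> M * norm (z - x)"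
      using assms(5) by (simp add: norm_minus_commute mult_right_mono)
    finally show ?thesis .
  qed
  then have "\<alpha> * (u \<bullet> (y - z)) \<le> \<alpha> * (M * norm (z - x))"
    using \<open>0 < \<alpha>\<close> by simp
  ultimately show ?thesis by linarith
qed

section \<open>What the line search guarantees about its output\<close>

lemma linesearchB_from_accepted:
  assumes "linesearchB_from T C \<delta> \<theta> M x u \<alpha>0 (\<alpha>, z, v)"
  shows "z = closest_point C (x - \<alpha> *\<^sub>R (T x + \<alpha> *\<^sub>R u)) \<and> v \<in> normal_cone C z \<and> norm v \<le> M \<and>
    \<alpha> * norm (T z - T x + \<alpha> *\<^sub>R v - \<alpha> *\<^sub>R u) \<le> \<delta> * norm (z - x)"
  using assms by (induction \<alpha>0 "(\<alpha>, z, v)" rule: linesearchB_from.induct) auto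

lemma linesearchB_from_step_bounds:
  assumes "linesearchB_from T C \<delta> \<theta> M x u \<alpha>0 (\<alpha>, z, v)" "0 < \<alpha>0" "0 < \<theta>" "\<theta> < 1"
  shows "0 < \<alpha> \<and> \<alpha> \<le> \<alpha>0"
  using assms(1,2)
proof (induction \<alpha>0 "(\<alpha>, z, v)" rule: linesearchB_from.induct)
  case (backtrack z' \<beta> v')
  then have "\<theta> * \<beta> \<le> \<beta>" "0 < \<theta> * \<beta>"
    using assms(3,4) by (auto simp: mult_le_cancel_right1)
  with backtrack show ?case by linarith
qed simp

text \<open>An output step other than the initial one was reached by backtracking. In the induction,
  either the recursive call accepts its first trial, and then the current trial is the last rejected
  one, or the witness comes from deeper in the loop.\<close>

lemma linesearchB_from_rejected:
  assumes "linesearchB_from T C \<delta> \<theta> M x u \<alpha>0 (\<alpha>, z, v)"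
  shows "\<alpha> = \<alpha>0 \<or> (\<exists>\<beta> z' v'. \<alpha> = \<theta> * \<beta> \<and> norm v' \<le> M \<and>
    z' = closest_point C (x - \<beta> *\<^sub>R (T x + \<beta> *\<^sub>R u)) \<and>
    \<delta> * norm (z' - x) < \<beta> * norm (T z' - T x + \<beta> *\<^sub>R v' - \<beta> *\<^sub>R u))"
  using assms
proof (induction \<alpha>0 "(\<alpha>, z, v)" rule: linesearchB_from.induct)
  case (backtrack z' \<beta> v')
  then show ?case by blast
qed simp

text \<open>Testing the projection inequality at \<open>x\<close> itself gives the estimate with
  \<open>T x + \<alpha> u\<close> and constant 1. Exchanging this vector for
  \<open>T z + \<alpha> v\<close> costs at most the fraction \<delta> of \<open>norm (z - x)\<close>
  squared, by the acceptance test. Thus \<open>x\<close> lies outside the halfspace by an amount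
  controlled by \<open>norm (z - x)\<close>.\<close>

lemma accepted_step_inner_ge:
  fixes C :: "'a::euclidean_space set"
  assumes "convex C" "closed C" "x \<in> C" "0 < \<alpha>"
    and z: "z = closest_point C (x - \<alpha> *\<^sub>R (T x + \<alpha> *\<^sub>R u))"
    and acc: "\<alpha> * norm (T z - T x + \<alpha> *\<^sub>R v - \<alpha> *\<^sub>R u) \<le> \<delta> * norm (z - x)"
  shows "(1 - \<delta>) * (norm (z - x))\<^sup>2 \<le> \<alpha> * ((T z + \<alpha> *\<^sub>R v) \<bullet> (x - z))"
proof -
  let ?e = "T z - T x + \<alpha> *\<^sub>R v - \<alpha> *\<^sub>R u"
  have "(x - \<alpha> *\<^sub>R (T x + \<alpha> *\<^sub>R u) - z) \<bullet> (x - z) \<le> 0"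
    unfolding z using assms(1-3) by (rule closest_point_dot)
  then have 1: "(norm (z - x))\<^sup>2 \<le> \<alpha> * ((T x + \<alpha> *\<^sub>R u) \<bullet> (x - z))"
    by (simp add: power2_norm_eq_inner algebra_simps inner_diff_left inner_diff_right
        inner_add_left inner_add_right inner_commute)
  have "\<alpha> * (- (?e \<bullet> (x - z))) \<le> \<alpha> * (norm ?e * norm (z - x))"
    using Cauchy_Schwarz_ineq2[of ?e "x - z"] \<open>0 < \<alpha>\<close>
    by (intro mult_left_mono) (auto simp: norm_minus_commute)
  also have "\<dots> \<le> \<delta> * norm (z - x) * norm (z - x)"
    using mult_right_mono[OF acc norm_ge_zero] by (simp add: mult.assoc)
  finally have "- (\<alpha> * (?e \<bullet> (x - z))) \<le> \<delta> * (norm (z - x))\<^sup>2"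
    by (simp add: power2_eq_square mult.assoc)
  moreover have "\<alpha> * ((T z + \<alpha> *\<^sub>R v) \<bullet> (x - z))
      = \<alpha> * ((T x + \<alpha> *\<^sub>R u) \<bullet> (x - z)) + \<alpha> * (?e \<bullet> (x - z))"
    unfolding distrib_left[symmetric] inner_add_left[symmetric] by (simp add: algebra_simps)
  ultimately show ?thesis using 1 by (simp add: left_diff_distrib)
qed

section \<open>Separating halfspaces and Fejer monotonicity\<close>

lemma sep_halfspace_closed_convex:
  "closed (sep_halfspace T z v)" "convex (sep_halfspace T z v)"
proof -
  have "sep_halfspace T z v = {y. (T z + v) \<bullet> y \<le> (T z + v) \<bullet> z}"
    by (auto simp: sep_halfspace_def inner_diff_right)
  then show "closed (sep_halfspace T z v)" "convex (sep_halfspace T z v)"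
    by (simp_all add: closed_halfspace_le convex_halfspace_le)
qed

text \<open>Duality gives the sign of the \<open>T z\<close> term, normality of \<open>v\<close> at
  \<open>z\<close> that of the other one.\<close>

lemma dual_VI_solutions_in_sep_halfspace:
  assumes "p \<in> dual_VI_solutions T C" "z \<in> C" "v \<in> normal_cone C z" "0 \<le> \<alpha>"
  shows "p \<in> sep_halfspace T z (\<alpha> *\<^sub>R v)"
proof -
  have "0 \<le> T z \<bullet> (z - p)" "v \<bullet> (p - z) \<le> 0"
    using assms by (auto simp: dual_VI_solutions_def normal_cone_def)
  moreover from this have "\<alpha> * (v \<bullet> (p - z)) \<le> 0"
    using assms(4) by (simp add: mult_nonneg_nonpos)
  ultimately show ?thesis
    by (simp add: sep_halfspace_def inner_add_left inner_diff_right right_diff_distrib)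
qed

text \<open>The product form avoids dividing by \<open>norm (T z + v)\<close>, so the degenerate
  case of a zero vector, where the halfspace is the whole space, is included.\<close>

lemma inner_le_dist_sep_halfspace:
  "(T z + v) \<bullet> (x - z) \<le> norm (T z + v) * norm (x - closest_point (sep_halfspace T z v) x)"
proof -
  let ?p = "closest_point (sep_halfspace T z v) x"
  have "z \<in> sep_halfspace T z v"
    by (simp add: sep_halfspace_def)
  then have "?p \<in> sep_halfspace T z v"
    using sep_halfspace_closed_convex(1) by (intro closest_point_in_set) auto
  then have "(T z + v) \<bullet> (x - z) \<le> (T z + v) \<bullet> (x - ?p)"
    by (simp add: sep_halfspace_def inner_diff_right)
  also have "\<dots> \<le> norm (T z + v) * norm (x - ?p)"
    by (rule norm_cauchy_schwarz)
  finally show ?thesis .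
qed

text \<open>The point \<open>p\<close> lies in both sets, so each of the two projections brings it
  no farther. The gain of the projection onto the halfspace is kept, that of the projection onto
  \<open>C\<close> is dropped.\<close>

lemma variant_B1_Fejer:
  fixes C :: "'a::euclidean_space set"
  assumes "convex C" "closed C" "p \<in> C" "p \<in> sep_halfspace T z w"
  shows "(norm (variant_B1 T C x z w - p))\<^sup>2
      + (norm (x - closest_point (sep_halfspace T z w) x))\<^sup>2 \<le> (norm (x - p))\<^sup>2"
proof -
  let ?q = "closest_point (sep_halfspace T z w) x"
  have "(norm (variant_B1 T C x z w - p))\<^sup>2 \<le> (norm (?q - p))\<^sup>2"
    using closest_point_Pythagoras_le[OF assms(1-3), of ?q]
      zero_le_power2[of "norm (?q - closest_point C ?q)"]
    unfolding variant_B1_def by linarith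
  then show ?thesis
    using closest_point_Pythagoras_le[OF sep_halfspace_closed_convex(2,1) assms(4), of x]
    by linarith
qed

section \<open>Passing to the limit in the projection inequality\<close>

lemma VI_solution_of_vanishing_steps:
  fixes T :: "'a::euclidean_space \<Rightarrow> 'a" and X Z U :: "nat \<Rightarrow> 'a" and \<alpha> :: "nat \<Rightarrow> real"
  assumes C: "convex C" "closed C" and T: "continuous_on C T"
    and X: "\<And>j. X j \<in> C" "X \<longlonglongrightarrow> l"
    and U: "\<And>j. U j \<in> normal_cone C (X j)" "\<And>j. norm (U j) \<le> M"
    and \<alpha>: "\<And>j. 0 < \<alpha> j" "\<alpha> \<longlonglongrightarrow> a"
    and Z: "\<And>j. Z j = closest_point C (X j - \<alpha> j *\<^sub>R (T (X j) + \<alpha> j *\<^sub>R U j))"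
    and small: "(\<lambda>j. norm (Z j - X j) / \<alpha> j) \<longlonglongrightarrow> 0"
  shows "l \<in> VI_solutions T C"
proof -
  have l: "l \<in> C"
    using C(2) X closed_sequentially by blast
  have TX: "(\<lambda>j. T (X j)) \<longlonglongrightarrow> T l"
    using T X l by (simp add: continuous_on_sequentially o_def)
  \<comment> \<open>Multiplying the small quotient back by the convergent step sizes shows that
    \<open>Z\<close> has the same limit as \<open>X\<close>. The limit \<open>a\<close> may be
    zero.\<close>
  have "(\<lambda>j. norm (Z j - X j) / \<alpha> j * \<alpha> j) \<longlonglongrightarrow> 0 * a"
    using small \<alpha>(2) by (rule tendsto_mult)
  moreover have "norm (Z j - X j) / \<alpha> j * \<alpha> j = norm (Z j - X j)" for j
    using \<alpha>(1)[of j] by simp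
  ultimately have ZX: "(\<lambda>j. norm (Z j - X j)) \<longlonglongrightarrow> 0"
    by simp
  then have "(\<lambda>j. (Z j - X j) + X j) \<longlonglongrightarrow> 0 + l"
    using X(2) by (intro tendsto_add) (auto simp: tendsto_norm_zero_iff)
  then have Zl: "Z \<longlonglongrightarrow> l" by simp
  have "0 \<le> T l \<bullet> (y - l)" if y: "y \<in> C" for y
  proof (rule LIMSEQ_le)
    show "(\<lambda>j. T (X j) \<bullet> (y - Z j)) \<longlonglongrightarrow> T l \<bullet> (y - l)"
      by (intro tendsto_intros TX Zl)
    have "(\<lambda>j. - (norm (Z j - X j) / \<alpha> j * norm (y - Z j)) - \<alpha> j * (M * norm (Z j - X j)))
        \<longlonglongrightarrow> - (0 * norm (y - l)) - a * (M * 0)"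
      by (intro tendsto_intros small ZX Zl \<alpha>(2))
    then show "(\<lambda>j. - (norm (Z j - X j) / \<alpha> j * norm (y - Z j)) - \<alpha> j * (M * norm (Z j - X j)))
        \<longlonglongrightarrow> 0" by simp
    show "\<exists>N. \<forall>j\<ge>N. - (norm (Z j - X j) / \<alpha> j * norm (y - Z j)) - \<alpha> j * (M * norm (Z j - X j))
        \<le> T (X j) \<bullet> (y - Z j)"
      using projected_step_inner_ge[OF C y U(1) U(2) \<alpha>(1) Z] by blast
  qed
  with l show ?thesis by (simp add: VI_solutions_def)
qed

text \<open>A bootstrap in two stages. The a priori step bound first gives that \<open>Z\<close> and
  \<open>X\<close> have a common limit; continuity then makes \<open>T (Z j) - T (X j)\<close>
  vanish, and the failed test turns this into the stronger statement that the displacement is small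
  even relative to \<beta>.\<close>

lemma VI_solution_of_rejected_steps:
  fixes T :: "'a::euclidean_space \<Rightarrow> 'a" and X Z U V :: "nat \<Rightarrow> 'a" and \<beta> :: "nat \<Rightarrow> real"
  assumes C: "convex C" "closed C" and T: "continuous_on C T"
    and X: "\<And>j. X j \<in> C" "X \<longlonglongrightarrow> l"
    and U: "\<And>j. U j \<in> normal_cone C (X j)" "\<And>j. norm (U j) \<le> M"
    and V: "\<And>j. norm (V j) \<le> M"
    and \<beta>: "\<And>j. 0 < \<beta> j" "\<beta> \<longlonglongrightarrow> 0" and "0 < \<delta>"
    and Z: "\<And>j. Z j = closest_point C (X j - \<beta> j *\<^sub>R (T (X j) + \<beta> j *\<^sub>R U j))"
    and rej: "\<And>j. \<delta> * norm (Z j - X j)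
        < \<beta> j * norm (T (Z j) - T (X j) + \<beta> j *\<^sub>R V j - \<beta> j *\<^sub>R U j)"
  shows "l \<in> VI_solutions T C"
proof -
  have l: "l \<in> C"
    using C(2) X closed_sequentially by blast
  have ZC: "Z j \<in> C" for j
    unfolding Z using C(2) l by (intro closest_point_in_set) auto
  have TX: "(\<lambda>j. T (X j)) \<longlonglongrightarrow> T l"
    using T X l by (simp add: continuous_on_sequentially o_def)
  have "(\<lambda>j. Z j - X j) \<longlonglongrightarrow> 0"
  proof (rule tendsto_0_le)
    have "(\<lambda>j. \<beta> j * (norm (T (X j)) + \<beta> j * M)) \<longlonglongrightarrow> 0 * (norm (T l) + 0 * M)"
      by (intro tendsto_intros TX \<beta>(2))
    then show "(\<lambda>j. \<beta> j * (norm (T (X j)) + \<beta> j * M)) \<longlonglongrightarrow> 0" by simp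
    have "norm (Z j - X j) \<le> \<beta> j * (norm (T (X j)) + \<beta> j * M)" for j
    proof -
      have "norm (Z j - X j) \<le> \<beta> j * (norm (T (X j)) + \<beta> j * norm (U j))"
        unfolding Z using C X(1) less_imp_le[OF \<beta>(1)] by (rule norm_projected_step_le)
      also have "\<dots> \<le> \<beta> j * (norm (T (X j)) + \<beta> j * M)"
        using \<beta>(1)[of j] U(2)[of j] by simp
      finally show ?thesis .
    qed
    then show "\<forall>\<^sub>F j in sequentially. norm (Z j - X j)
        \<le> norm (\<beta> j * (norm (T (X j)) + \<beta> j * M)) * 1"
      by (smt (verit) eventuallyI real_norm_def mult_1_right)
  qed
  then have "(\<lambda>j. (Z j - X j) + X j) \<longlonglongrightarrow> 0 + l"
    using X(2) by (rule tendsto_add)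
  then have "Z \<longlonglongrightarrow> l" by simp
  then have TZ: "(\<lambda>j. T (Z j)) \<longlonglongrightarrow> T l"
    using T ZC l by (simp add: continuous_on_sequentially o_def)
  have "(\<lambda>j. norm (Z j - X j) / \<beta> j) \<longlonglongrightarrow> 0"
  proof (rule tendsto_0_le)
    have "(\<lambda>j. (norm (T (Z j) - T (X j)) + \<beta> j * (2 * M)) / \<delta>)
        \<longlonglongrightarrow> (norm (T l - T l) + 0 * (2 * M)) / \<delta>"
      using \<open>0 < \<delta>\<close> by (intro tendsto_intros TX TZ \<beta>(2)) auto
    then show "(\<lambda>j. (norm (T (Z j) - T (X j)) + \<beta> j * (2 * M)) / \<delta>) \<longlonglongrightarrow> 0" by simp
    \<comment> \<open>This is the rejection divided by \<delta> and \<beta>. The constant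
      \<open>2 * M\<close> bounds the difference of \<open>V j\<close> and
      \<open>U j\<close>.\<close>
    have "norm (Z j - X j) / \<beta> j \<le> (norm (T (Z j) - T (X j)) + \<beta> j * (2 * M)) / \<delta>" for j
    proof -
      have "norm (T (Z j) - T (X j) + \<beta> j *\<^sub>R V j - \<beta> j *\<^sub>R U j)
          = norm ((T (Z j) - T (X j)) + \<beta> j *\<^sub>R (V j - U j))"
        by (simp add: algebra_simps)
      also have "\<dots> \<le> norm (T (Z j) - T (X j)) + \<beta> j * norm (V j - U j)"
        using norm_triangle_ineq[of "T (Z j) - T (X j)" "\<beta> j *\<^sub>R (V j - U j)"] \<beta>(1)[of j] by simp
      also have "\<dots> \<le> norm (T (Z j) - T (X j)) + \<beta> j * (2 * M)"
        using norm_triangle_ineq4[of "V j" "U j"] U(2)[of j] V[of j] \<beta>(1)[of j] by simp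
      finally have "\<beta> j * norm (T (Z j) - T (X j) + \<beta> j *\<^sub>R V j - \<beta> j *\<^sub>R U j)
          \<le> \<beta> j * (norm (T (Z j) - T (X j)) + \<beta> j * (2 * M))"
        using \<beta>(1)[of j] by simp
      with rej[of j] have "\<delta> * norm (Z j - X j)
          \<le> \<beta> j * (norm (T (Z j) - T (X j)) + \<beta> j * (2 * M))"
        by linarith
      then show ?thesis
        using \<beta>(1)[of j] \<open>0 < \<delta>\<close> by (simp add: pos_divide_le_eq pos_le_divide_eq mult.commute)
    qed
    then show "\<forall>\<^sub>F j in sequentially. norm (norm (Z j - X j) / \<beta> j)
        \<le> norm ((norm (T (Z j) - T (X j)) + \<beta> j * (2 * M)) / \<delta>) * 1"
      using less_imp_le[OF \<beta>(1)] by (intro always_eventually allI) (smt (verit)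
        divide_nonneg_nonneg norm_ge_zero real_norm_def mult_1_right)
  qed
  then show ?thesis
    using VI_solution_of_vanishing_steps[OF C T X U \<beta> Z] by blast
qed

text \<open>Once a single term of the subsequence is within \<open>e\<close> of \<open>l\<close>,
  monotonicity keeps all later terms there.\<close>

lemma LIMSEQ_of_decreasing_dist_subseq:
  fixes x :: "nat \<Rightarrow> 'a::metric_space"
  assumes "\<And>k. dist (x (Suc k)) l \<le> dist (x k) l" "strict_mono r" "(x \<circ> r) \<longlonglongrightarrow> l"
  shows "x \<longlonglongrightarrow> l"
proof (rule metric_LIMSEQ_I)
  fix e :: real assume "0 < e"
  with assms(3) obtain j where j: "dist (x (r j)) l < e"
    unfolding lim_sequentially by (auto simp: o_def)
  have "dist (x n) l < e" if "r j \<le> n" for n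
    using lift_Suc_antimono_le[of "\<lambda>k. dist (x k) l" "r j" n] assms(1) that j by force
  then show "\<exists>N. \<forall>n\<ge>N. dist (x n) l < e" by blast
qed

section \<open>Boundedness, vanishing displacements and cluster points of the iterates\<close>

theorem theorem3p6:
  fixes T :: "real ^ 'n \<Rightarrow> real ^ 'n" and C :: "(real ^ 'n) set"
    and \<sigma> \<delta> \<theta> M :: real and x :: "nat \<Rightarrow> real ^ 'n"
  assumes "C \<noteq> {}" and "closed C" and "convex C"
    and "\<sigma> > 0" and "0 < \<delta>" and "\<delta> < 1" and "0 < \<theta>" and "\<theta> < 1" and "M > 0"
    and "continuous_on C T"
    and "VI_solutions T C \<noteq> {}"
    and "VI_solutions T C \<subseteq> dual_VI_solutions T C"
    and "algorithmB_sequence (variant_B1 T C) T C \<sigma> \<delta> \<theta> M x"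
    and "\<forall>k. x k \<notin> VI_solutions T C"
  shows "\<exists>xs \<in> VI_solutions T C. x \<longlonglongrightarrow> xs"
proof -
  note C = \<open>convex C\<close> \<open>closed C\<close>
  have x0: "x 0 \<in> C"
    and "\<forall>k. \<exists>u \<alpha> z v. u \<in> normal_cone C (x k) \<and> norm u \<le> M \<and>
      linesearchB_from T C \<delta> \<theta> M (x k) u \<sigma> (\<alpha>, z, v) \<and>
      x (Suc k) = variant_B1 T C (x k) z (\<alpha> *\<^sub>R v)"
    using assms(13) unfolding algorithmB_sequence_def linesearchB_def by auto
  then obtain u \<alpha> z v where u: "\<And>k. u k \<in> normal_cone C (x k)" "\<And>k. norm (u k) \<le> M"
    and ls: "\<And>k. linesearchB_from T C \<delta> \<theta> M (x k) (u k) \<sigma> (\<alpha> k, z k, v k)"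
    and x_Suc: "\<And>k. x (Suc k) = variant_B1 T C (x k) (z k) (\<alpha> k *\<^sub>R v k)"
    by metis
  define d where "d k = norm (x k - closest_point (sep_halfspace T (z k) (\<alpha> k *\<^sub>R v k)) (x k))" for k
  have xC: "x k \<in> C" for k
    using x0 C(2) \<open>C \<noteq> {}\<close>
    by (cases k) (auto simp: x_Suc variant_B1_def closest_point_in_set)
  have z: "z k = closest_point C (x k - \<alpha> k *\<^sub>R (T (x k) + \<alpha> k *\<^sub>R u k))"
    and v: "v k \<in> normal_cone C (z k)" "norm (v k) \<le> M"
    and acc: "\<alpha> k * norm (T (z k) - T (x k) + \<alpha> k *\<^sub>R v k - \<alpha> k *\<^sub>R u k) \<le> \<delta> * norm (z k - x k)" for k
    using linesearchB_from_accepted[OF ls] by blast+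
  have \<alpha>: "0 < \<alpha> k" "\<alpha> k \<le> \<sigma>" for k
    using linesearchB_from_step_bounds[OF ls \<open>0 < \<sigma>\<close> \<open>0 < \<theta>\<close> \<open>\<theta> < 1\<close>] by auto
  have zC: "z k \<in> C" for k
    unfolding z using C(2) \<open>C \<noteq> {}\<close> by (rule closest_point_in_set)
  have Fejer: "(norm (x (Suc k) - p))\<^sup>2 + (d k)\<^sup>2 \<le> (norm (x k - p))\<^sup>2"
    if "p \<in> VI_solutions T C" for p k
  proof -
    have "p \<in> dual_VI_solutions T C" "p \<in> C"
      using that assms(12) by (auto simp: VI_solutions_def)
    then show ?thesis
      unfolding x_Suc d_def using zC v(1) less_imp_le[OF \<alpha>(1)]
      by (intro variant_B1_Fejer C dual_VI_solutions_in_sep_halfspace) auto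
  qed
  have dist_le: "dist (x (Suc k)) p \<le> dist (x k) p" if "p \<in> VI_solutions T C" for p k
  proof -
    have "(norm (x (Suc k) - p))\<^sup>2 \<le> (norm (x k - p))\<^sup>2"
      using Fejer[OF that, of k] zero_le_power2[of "d k"] by linarith
    then show ?thesis by (simp add: dist_norm)
  qed
  obtain p where p: "p \<in> VI_solutions T C"
    using assms(11) by blast
  \<comment> \<open>The Fejer inequality telescopes; the induction below carries the last distance
    along so that the sum closes.\<close>
  have "summable (\<lambda>k. (d k)\<^sup>2)"
  proof (rule summableI_nonneg_bounded)
    show "(\<Sum>i<n. (d i)\<^sup>2) \<le> (norm (x 0 - p))\<^sup>2" for n
    proof -
      have "(\<Sum>i<n. (d i)\<^sup>2) + (norm (x n - p))\<^sup>2 \<le> (norm (x 0 - p))\<^sup>2"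
      proof (induction n)
        case (Suc n)
        then show ?case using Fejer[OF p, of n] by simp
      qed simp
      then show ?thesis using zero_le_power2[of "norm (x n - p)"] by linarith
    qed
  qed simp
  then have "(\<lambda>k. (d k)\<^sup>2) \<longlonglongrightarrow> 0"
    by (rule summable_LIMSEQ_zero)
  then have d0: "d \<longlonglongrightarrow> 0"
    by (auto dest: tendsto_real_sqrt simp: d_def[abs_def])

  \<comment> \<open>By continuity \<open>T\<close> is bounded on the compact set cut out of
    \<open>C\<close> by any ball around \<open>p\<close>. This is used for two radii, one for the
    iterates and a larger one for the points \<open>z k\<close>.\<close>
  have T_bounded: "\<exists>B. \<forall>y. y \<in> C \<longrightarrow> dist y p \<le> R \<longrightarrow> norm (T y) \<le> B" for R
  proof -
    have "compact (T ` (C \<inter> cball p R))"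
      using C(2) assms(10)
      by (intro compact_continuous_image) (auto intro: continuous_on_subset closed_Int_compact)
    then obtain B where "\<forall>w \<in> T ` (C \<inter> cball p R). norm w \<le> B"
      by (meson compact_imp_bounded bounded_iff)
    then have "\<forall>y. y \<in> C \<longrightarrow> dist y p \<le> R \<longrightarrow> norm (T y) \<le> B"
      by (simp add: dist_commute)
    then show ?thesis ..
  qed
  define R where "R = dist (x 0) p"
  have xR: "dist (x k) p \<le> R" for k
    using lift_Suc_antimono_le[of "\<lambda>k. dist (x k) p" 0 k] dist_le[OF p] by (simp add: R_def)
  obtain B1 where B1: "\<And>y. y \<in> C \<Longrightarrow> dist y p \<le> R \<Longrightarrow> norm (T y) \<le> B1"
    using T_bounded[of R] by blast
  \<comment> \<open>The radius \<open>R\<close> of the ball containing the iterates, enlarged by the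
    greatest possible length of a projected step with step size at most \<sigma>.\<close>
  define R2 where "R2 = R + \<sigma> * (B1 + \<sigma> * M)"
  have zR2: "dist (z k) p \<le> R2" for k
  proof -
    have "norm (z k - x k) \<le> \<alpha> k * (norm (T (x k)) + \<alpha> k * norm (u k))"
      unfolding z using C xC less_imp_le[OF \<alpha>(1)] by (rule norm_projected_step_le)
    also have "\<dots> \<le> \<sigma> * (B1 + \<sigma> * M)"
      using \<alpha>[of k] B1[OF xC xR, of k] u(2)[of k] by (intro mult_mono add_mono add_nonneg_nonneg) auto
    finally show ?thesis
      using dist_triangle[of "z k" p "x k"] xR[of k] by (simp add: R2_def dist_norm)
  qed
  obtain B2 where B2: "\<And>y. y \<in> C \<Longrightarrow> dist y p \<le> R2 \<Longrightarrow> norm (T y) \<le> B2"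
    using T_bounded[of R2] by blast
  \<comment> \<open>The accepted step bounds the displacement by an inner product, which is in turn
    at most the norm of the halfspace's normal vector times \<open>d k\<close>. That norm is
    uniformly bounded by \<open>B2 + \<sigma> * M\<close>.\<close>
  have gap: "(1 - \<delta>) * (norm (z k - x k))\<^sup>2 \<le> \<sigma> * ((B2 + \<sigma> * M) * d k)" for k
  proof -
    have d: "0 \<le> d k" by (simp add: d_def)
    have "norm (T (z k) + \<alpha> k *\<^sub>R v k) \<le> norm (T (z k)) + \<alpha> k * norm (v k)"
      using norm_triangle_ineq[of "T (z k)" "\<alpha> k *\<^sub>R v k"] \<alpha>(1)[of k] by simp
    also have "\<dots> \<le> B2 + \<sigma> * M"
      using \<alpha>[of k] B2[OF zC zR2, of k] v(2)[of k] by (intro add_mono mult_mono) auto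
    finally have w: "norm (T (z k) + \<alpha> k *\<^sub>R v k) \<le> B2 + \<sigma> * M" .
    have "(1 - \<delta>) * (norm (z k - x k))\<^sup>2 \<le> \<alpha> k * ((T (z k) + \<alpha> k *\<^sub>R v k) \<bullet> (x k - z k))"
      using C xC \<alpha>(1) z acc by (rule accepted_step_inner_ge)
    also have "\<dots> \<le> \<alpha> k * (norm (T (z k) + \<alpha> k *\<^sub>R v k) * d k)"
      unfolding d_def using \<alpha>(1)[of k] inner_le_dist_sep_halfspace by (intro mult_left_mono) auto
    also have "\<dots> \<le> \<sigma> * ((B2 + \<sigma> * M) * d k)"
      using \<alpha>[of k] w d order_trans[OF norm_ge_zero w] by (intro mult_mono mult_nonneg_nonneg) auto
    finally show ?thesis .
  qed
  have zx: "(\<lambda>k. norm (z k - x k)) \<longlonglongrightarrow> 0"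
  proof -
    have "(\<lambda>k. (norm (z k - x k))\<^sup>2) \<longlonglongrightarrow> 0"
    proof (rule tendsto_sandwich[OF _ _ tendsto_const])
      have "(\<lambda>k. \<sigma> * ((B2 + \<sigma> * M) * d k) / (1 - \<delta>)) \<longlonglongrightarrow> \<sigma> * ((B2 + \<sigma> * M) * 0) / (1 - \<delta>)"
        using \<open>\<delta> < 1\<close> by (intro tendsto_intros d0) auto
      then show "(\<lambda>k. \<sigma> * ((B2 + \<sigma> * M) * d k) / (1 - \<delta>)) \<longlonglongrightarrow> 0" by simp
      show "\<forall>\<^sub>F k in sequentially. (norm (z k - x k))\<^sup>2 \<le> \<sigma> * ((B2 + \<sigma> * M) * d k) / (1 - \<delta>)"
        using gap \<open>\<delta> < 1\<close> by (auto simp: pos_le_divide_eq mult.commute)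
    qed auto
    then show ?thesis by (auto dest: tendsto_real_sqrt)
  qed

  \<comment> \<open>Compactness is applied to pairs, so that one subsequence serves iterates and
    step sizes simultaneously.\<close>
  have "compact (cball p R \<times> {0..\<sigma>})"
    by (intro compact_Times) auto
  moreover have "\<forall>k. (x k, \<alpha> k) \<in> cball p R \<times> {0..\<sigma>}"
    using xR \<alpha> by (auto simp: dist_commute less_imp_le)
  ultimately obtain la r where r: "strict_mono r" and la: "((\<lambda>k. (x k, \<alpha> k)) \<circ> r) \<longlonglongrightarrow> la"
    unfolding compact_def by meson
  define l a where "l = fst la" and "a = snd la"
  have xr: "(\<lambda>j. x (r j)) \<longlonglongrightarrow> l" and \<alpha>r: "(\<lambda>j. \<alpha> (r j)) \<longlonglongrightarrow> a"
    using tendsto_fst[OF la] tendsto_snd[OF la] by (simp_all add: o_def l_def a_def)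
  have "l \<in> VI_solutions T C"
  proof (cases "a = 0")
    case False
    have "(\<lambda>j. norm (z (r j) - x (r j)) / \<alpha> (r j)) \<longlonglongrightarrow> 0 / a"
      using False LIMSEQ_subseq_LIMSEQ[OF zx r] by (intro tendsto_divide \<alpha>r) (auto simp: o_def)
    then show ?thesis
      using VI_solution_of_vanishing_steps[OF C assms(10) xC xr u(1) u(2) \<alpha>(1) \<alpha>r z] by simp
  next
    case True
    \<comment> \<open>Step sizes tending to zero are eventually below the initial trial \<sigma>, so
      a rejection must have occurred. Shifting the subsequence by \<open>N\<close> secures this for
      every index.\<close>
    then have "\<forall>\<^sub>F j in sequentially. \<alpha> (r j) < \<sigma>"
      using \<alpha>r \<open>\<sigma> > 0\<close> by (simp add: order_tendstoD)
    then obtain N where N: "\<And>j. N \<le> j \<Longrightarrow> \<alpha> (r j) < \<sigma>"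
      by (auto simp: eventually_sequentially)
    define q where "q j = r (j + N)" for j
    have xq: "(\<lambda>j. x (q j)) \<longlonglongrightarrow> l" and \<alpha>q: "(\<lambda>j. \<alpha> (q j)) \<longlonglongrightarrow> 0"
      using LIMSEQ_ignore_initial_segment[OF xr, of N] LIMSEQ_ignore_initial_segment[OF \<alpha>r, of N] True
      by (simp_all add: q_def)
    have "\<forall>j. \<exists>\<beta> z' v'. \<alpha> (q j) = \<theta> * \<beta> \<and> norm v' \<le> M \<and>
        z' = closest_point C (x (q j) - \<beta> *\<^sub>R (T (x (q j)) + \<beta> *\<^sub>R u (q j))) \<and>
        \<delta> * norm (z' - x (q j)) < \<beta> * norm (T z' - T (x (q j)) + \<beta> *\<^sub>R v' - \<beta> *\<^sub>R u (q j))" (is "\<forall>j. ?rejected j")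
    proof
      fix j
      have "\<alpha> (q j) \<noteq> \<sigma>"
        using N[of "j + N"] by (simp add: q_def)
      with linesearchB_from_rejected[OF ls, of "q j"] show "?rejected j" by blast
    qed
    then obtain \<beta> Z V where \<beta>: "\<And>j. \<alpha> (q j) = \<theta> * \<beta> j" and V: "\<And>j. norm (V j) \<le> M"
      and Z: "\<And>j. Z j = closest_point C (x (q j) - \<beta> j *\<^sub>R (T (x (q j)) + \<beta> j *\<^sub>R u (q j)))"
      and rej: "\<And>j. \<delta> * norm (Z j - x (q j))
          < \<beta> j * norm (T (Z j) - T (x (q j)) + \<beta> j *\<^sub>R V j - \<beta> j *\<^sub>R u (q j))"
      unfolding choice_iff by blast
    \<comment> \<open>The last rejected trial exceeds the accepted step only by the fixed factor
      \<open>1 / \<theta>\<close>, hence it tends to zero as well.\<close>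
    have \<beta>_eq: "\<beta> j = \<alpha> (q j) / \<theta>" for j
      using \<beta>[of j] \<open>0 < \<theta>\<close> by simp
    have "0 < \<beta> j" for j
      using \<beta>_eq \<alpha>(1) \<open>0 < \<theta>\<close> by simp
    moreover have "\<beta> \<longlonglongrightarrow> 0"
      using tendsto_divide[OF \<alpha>q tendsto_const[of \<theta>]] \<open>0 < \<theta>\<close> by (simp add: \<beta>_eq[abs_def])
    ultimately show ?thesis
      using VI_solution_of_rejected_steps[OF C assms(10) xC xq u(1) u(2) V _ _ \<open>0 < \<delta>\<close> Z rej]
      by blast
  qed
  \<comment> \<open>Now that \<open>l\<close> is known to be a solution, Fejer monotonicity applies
    with \<open>l\<close> itself in place of \<open>p\<close>.\<close>
  moreover from this have "x \<longlonglongrightarrow> l"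
    using dist_le r xr by (intro LIMSEQ_of_decreasing_dist_subseq[of x l r]) (auto simp: o_def)
  ultimately show ?thesis by blast
qed

end
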